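(* For every integer $k\ge 0$, an interval graph $G$ is $k$-Hamilton-connected if and only if $\mathrm{scat}(G)\le -(k+1)$.
   Context: All graphs are finite, undirected, without loops or multiple edges. An interval graph is the intersection graph of a finite set of closed intervals on the real line. A graph $G$ is Hamilton-connected if for every two distinct vertices $s,t$ of $G$ there is a Hamilton path (a path through all vertices) with end-vertices $s$ and $t$. For an integer $k\ge 0$, $G$ is $k$-Hamilton-connected if $G-S$ is Hamilton-connected for every set $S\subset V(G)$ with $|S|\le k$. For a graph $G$, $c(G)$ denotes its number of connected components. The scattering number is $\mathrm{scat}(G)=\max\{c(G-S)-|S| : S\subset V(G),\ c(G-S)\ge 2\}$, with $\mathrm{scat}(G)=-\infty$ if $G$ is complete. *)

theory Defs
  imports Complex_Main "HOL-Library.Extended_Real" "Graph_Theory.Graph_Theory"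
begin

text \<open>
  A finite simple undirected graph is an instance of the locale \<^locale>\<open>graph\<close>: a finite
  symmetric digraph without loops or parallel arcs. Each edge is a pair of opposite arcs, and
  adjacency is membership in \<^const>\<open>arcs_ends\<close>.
\<close>

text \<open>
  Intervals are assigned to vertices by a map that need not be injective, so distinct vertices
  may carry the same interval.
\<close>

definition interval_graph :: "('a, 'b) pre_digraph \<Rightarrow> bool" where
  "interval_graph G \<longleftrightarrow> graph G \<and>
     (\<exists>l r :: 'a \<Rightarrow> real.
        (\<forall>v \<in> verts G. l v \<le> r v) \<and>
        (\<forall>u \<in> verts G. \<forall>v \<in> verts G.
           u \<rightarrow>\<^bsub>G\<^esub> v \<longleftrightarrow> u \<noteq> v \<and> {l u..r u} \<inter> {l v..r v} \<noteq> {}))"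

definition del_verts :: "('a, 'b) pre_digraph \<Rightarrow> 'a set \<Rightarrow> ('a, 'b) pre_digraph" where
  "del_verts G S = G \<restriction> (verts G - S)"

definition hamilton_path ::
    "('a, 'b) pre_digraph \<Rightarrow> 'a \<Rightarrow> 'a vwalk \<Rightarrow> 'a \<Rightarrow> bool" where
  "hamilton_path G s p t \<longleftrightarrow> vpath p G \<and> set p = verts G \<and> hd p = s \<and> last p = t"

definition hamilton_connected :: "('a, 'b) pre_digraph \<Rightarrow> bool" where
  "hamilton_connected G \<longleftrightarrow>
     (\<forall>s \<in> verts G. \<forall>t \<in> verts G. s \<noteq> t \<longrightarrow> (\<exists>p. hamilton_path G s p t))"

definition k_hamilton_connected :: "nat \<Rightarrow> ('a, 'b) pre_digraph \<Rightarrow> bool" where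
  "k_hamilton_connected k G \<longleftrightarrow>
     (\<forall>S. S \<subseteq> verts G \<and> card S \<le> k \<longrightarrow> hamilton_connected (del_verts G S))"

text \<open>In a symmetric digraph the strongly connected components are the connected components.\<close>

definition num_components :: "('a, 'b) pre_digraph \<Rightarrow> nat" where
  "num_components G = card (pre_digraph.sccs G)"

definition complete_graph :: "('a, 'b) pre_digraph \<Rightarrow> bool" where
  "complete_graph G \<longleftrightarrow> complete_digraph (card (verts G)) G"

text \<open>
  For a finite graph that is not complete, the set below is finite and nonempty: deleting all
  vertices other than two nonadjacent ones leaves two components.
\<close>

definition scattering_number :: "('a, 'b) pre_digraph \<Rightarrow> ereal" where
  "scattering_number G =
     (if complete_graph G then - \<infinity>
      else ereal (Max {real (num_components (del_verts G S)) - real (card S) | S.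
             S \<subseteq> verts G \<and> num_components (del_verts G S) \<ge> 2}))"

end

theory Submission
  imports Defs
begin

text \<open>
  Delete \<open>k\<close> vertices of a separator \<open>S\<close> and take a Hamilton path of the rest whose ends are in \<open>S\<close>.
  Removing the other \<open>card S - k\<close> vertices of \<open>S\<close> from it leaves at most \<open>card S - k - 1\<close> segments,
  and every component of \<open>G - S\<close> contains one of them. This gives one direction, for arbitrary graphs.

  For the other direction, deleting at most \<open>k\<close> vertices reduces the claim to \<open>k = 0\<close>. Sweep the
  intervals from left to right with three of them running at any time. In each step the running
  interval with the smallest right endpoint is eliminated and replaced by the interval, among the
  remaining ones that it meets, with the smallest right endpoint. If the sweep gets stuck, a set
  \<open>S\<close> with at least \<open>card S\<close> components in its complement is read off. Otherwise each vertex is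
  adjacent to the three vertices running after its elimination, one of which is the next to go.
  Going back through the sweep, one maintains that any two remaining vertices are the ends of a
  Hamilton path of the remaining vertices that has two consecutive vertices among the three running
  ones; the vertex to be reinserted goes between these two.
\<close>

section \<open>Hamilton paths with a slot for one more vertex\<close>

definition ham_through :: "('a \<Rightarrow> 'a \<Rightarrow> bool) \<Rightarrow> 'a set \<Rightarrow> 'a set \<Rightarrow> bool" where
  "ham_through E X F \<longleftrightarrow>
     (\<forall>s \<in> X. \<forall>t \<in> X. s \<noteq> t \<longrightarrow>
        (\<exists>p q y z. y \<in> F \<and> z \<in> F \<and> distinct (p @ y # z # q) \<and> set (p @ y # z # q) = X \<and>
           hd (p @ y # z # q) = s \<and> last (p @ y # z # q) = t \<and> successively E (p @ y # z # q)))"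

lemma ham_throughI:
  assumes "\<And>s t. \<lbrakk>s \<in> X; t \<in> X; s \<noteq> t\<rbrakk> \<Longrightarrow> \<exists>p q y z. y \<in> F \<and> z \<in> F \<and>
     distinct (p @ y # z # q) \<and> set (p @ y # z # q) = X \<and>
     hd (p @ y # z # q) = s \<and> last (p @ y # z # q) = t \<and> successively E (p @ y # z # q)"
  shows "ham_through E X F"
  unfolding ham_through_def using assms by blast

lemma ham_throughE:
  assumes "ham_through E X F" "s \<in> X" "t \<in> X" "s \<noteq> t"
  obtains p q y z where "y \<in> F" "z \<in> F" "distinct (p @ y # z # q)" "set (p @ y # z # q) = X"
    "hd (p @ y # z # q) = s" "last (p @ y # z # q) = t" "successively E (p @ y # z # q)"
  using assms unfolding ham_through_def by blast

lemma ham_through_path: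
  assumes "ham_through E X F" "s \<in> X" "t \<in> X" "s \<noteq> t"
  obtains p where "distinct p" "set p = X" "hd p = s" "last p = t" "successively E p"
  using ham_throughE[OF assms] by metis

text \<open>Base of the way back: the only inner vertex is adjacent to both ends and forms the
  required pair with \<open>s\<close>.\<close>

lemma ham_through_triangle:
  assumes "card F = 3" "\<And>x y. \<lbrakk>x \<in> F; y \<in> F\<rbrakk> \<Longrightarrow> E x y"
  shows "ham_through E F F"
proof (rule ham_throughI)
  fix s t assume st: "s \<in> F" "t \<in> F" "s \<noteq> t"
  have fin: "finite F"
    using assms(1) by (metis card.infinite zero_neq_numeral)
  have "card (F - {s, t}) = 1"
    using st assms(1) fin by (simp add: card_Diff_subset)
  then obtain m where "F - {s, t} = {m}"
    by (auto simp: card_1_singleton_iff)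
  then have "F = {s, m, t}" "m \<noteq> s" "m \<noteq> t"
    using st by auto
  then have "s \<in> F \<and> m \<in> F \<and> distinct ([] @ s # m # [t]) \<and> set ([] @ s # m # [t]) = F \<and>
     hd ([] @ s # m # [t]) = s \<and> last ([] @ s # m # [t]) = t \<and> successively E ([] @ s # m # [t])"
    using assms(2) st by auto
  then show "\<exists>p q y z. y \<in> F \<and> z \<in> F \<and> distinct (p @ y # z # q) \<and> set (p @ y # z # q) = F \<and>
     hd (p @ y # z # q) = s \<and> last (p @ y # z # q) = t \<and> successively E (p @ y # z # q)"
    by blast
qed

text \<open>
  Of two consecutive vertices of \<open>{p, q, w}\<close> on a path of \<open>X\<close>, one lies in \<open>{p, q}\<close>, so
  after \<open>u\<close> is inserted between them the new path has consecutive vertices in \<open>{u, p, q}\<close>.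
\<close>

lemma ham_through_insert:
  assumes hx: "ham_through E X {p, q, w}"
    and sub: "{p, q, w} \<subseteq> X" and u: "u \<notin> X" and pq: "p \<noteq> q"
    and adj: "\<And>x. x \<in> {p, q, w} \<Longrightarrow> E u x \<and> E x u"
  shows "ham_through E (insert u X) {u, p, q}"
proof (rule ham_throughI)
  fix s t assume st: "s \<in> insert u X" "t \<in> insert u X" "s \<noteq> t"
  let ?goal = "\<exists>a b y z. y \<in> {u, p, q} \<and> z \<in> {u, p, q} \<and> distinct (a @ y # z # b) \<and>
     set (a @ y # z # b) = insert u X \<and> hd (a @ y # z # b) = s \<and> last (a @ y # z # b) = t \<and>
     successively E (a @ y # z # b)"
  have goalI: ?goal
    if "y \<in> {u, p, q}" "z \<in> {u, p, q}" "distinct (a @ y # z # b)" "set (a @ y # z # b) = insert u X"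
      "hd (a @ y # z # b) = s" "last (a @ y # z # b) = t" "successively E (a @ y # z # b)"
    for y z a b
    using that by blast
  consider "s = u" | "t = u" | "s \<noteq> u" "t \<noteq> u" by blast
  then show ?goal
  proof cases
    case 1
    \<comment> \<open>With \<open>u\<close> as an end, the new pair is \<open>u\<close> and its
      neighbour on the path, which must therefore be \<open>p\<close> or \<open>q\<close>.\<close>
    obtain y where y: "y \<in> {p, q}" "y \<noteq> t" using pq by blast
    have "y \<in> X" "t \<in> X" using y sub st 1 by auto
    from ham_through_path[OF hx this y(2)] obtain c
      where c: "distinct c" "set c = X" "hd c = y" "last c = t" "successively E c" .
    then obtain c' where c': "c = y # c'" using \<open>y \<in> X\<close> by (cases c) auto
    show ?thesis
      by (rule goalI[where a = "[]" and y = u and z = y and b = c'])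
        (use c c' y u 1 adj in \<open>auto simp: successively_Cons\<close>)
  next
    case 2
    obtain y where y: "y \<in> {p, q}" "s \<noteq> y" using pq by blast
    have "y \<in> X" "s \<in> X" using y sub st 2 by auto
    from ham_through_path[OF hx this(2,1) y(2)] obtain c
      where c: "distinct c" "set c = X" "hd c = s" "last c = y" "successively E c" .
    then obtain c' where c': "c = c' @ [y]" using \<open>y \<in> X\<close> by (cases c rule: rev_cases) auto
    show ?thesis
      by (rule goalI[where a = c' and y = y and z = u and b = "[]"])
        (use c c' y u 2 adj in \<open>auto simp: successively_append_iff hd_append split: if_splits\<close>)
  next
    case 3
    then have "s \<in> X" "t \<in> X" using st by auto
    from ham_throughE[OF hx this st(3)] obtain a b y z
      where c: "y \<in> {p, q, w}" "z \<in> {p, q, w}" "distinct (a @ y # z # b)" "set (a @ y # z # b) = X"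
        "hd (a @ y # z # b) = s" "last (a @ y # z # b) = t" "successively E (a @ y # z # b)" .
    have suc: "successively E (a @ y # u # z # b)"
      using c(7) adj[OF c(1)] adj[OF c(2)] by (auto simp: successively_append_iff successively_Cons)
    have hd: "hd (a @ y # u # z # b) = s" using c(5) by (cases a) auto
    have la: "last (a @ y # u # z # b) = t" using c(6) by auto
    have di: "distinct (a @ y # u # z # b)" using c(3,4) u by auto
    have se: "set (a @ y # u # z # b) = insert u X" using c(4) by auto
    have "y \<in> {p, q} \<or> z \<in> {p, q}" using c(1-3) by auto
    then show ?thesis
    proof
      assume "y \<in> {p, q}"
      then show ?thesis
        by (intro goalI[where a = a and y = y and z = u and b = "z # b"]) (use suc hd la di se in auto)
    next
      assume "z \<in> {p, q}"
      then show ?thesis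
        by (intro goalI[where a = "a @ [y]" and y = u and z = z and b = b])
          (use suc hd la di se in auto)
    qed
  qed
qed

section \<open>The sweep over a family of intervals\<close>

locale interval_family =
  fixes V :: "'a set" and l r :: "'a \<Rightarrow> real"
  assumes finite_V: "finite V"
    and l_le_r: "x \<in> V \<Longrightarrow> l x \<le> r x"
begin

definition meet :: "'a \<Rightarrow> 'a \<Rightarrow> bool" where
  "meet x y \<longleftrightarrow> l x \<le> r y \<and> l y \<le> r x"

text \<open>A map constant on meeting intervals stands in for the partition into components.\<close>

definition splits :: "'a set \<Rightarrow> nat \<Rightarrow> bool" where
  "splits X n \<longleftrightarrow>
     (\<exists>f :: 'a \<Rightarrow> nat. (\<forall>x \<in> X. \<forall>y \<in> X. meet x y \<longrightarrow> f x = f y) \<and> card (f ` X) = n)"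

lemma splits_one: "X \<noteq> {} \<Longrightarrow> splits X 1"
  unfolding splits_def by (rule exI[of _ "\<lambda>_. 0"]) (simp add: image_constant_conv)

text \<open>No interval of \<open>X\<close> meets one of \<open>Z\<close>, so all of
  \<open>Z\<close> can get one fresh value. \<open>Z\<close> itself may be disconnected: a lower
  bound on the number of components suffices.\<close>

lemma splits_append:
  assumes "splits X n" "X \<subseteq> V" "Z \<noteq> {}"
    and "\<And>x. x \<in> X \<Longrightarrow> r x \<le> \<theta>" and "\<And>z. z \<in> Z \<Longrightarrow> \<theta> < l z"
  shows "splits (X \<union> Z) (Suc n)"
proof -
  obtain f :: "'a \<Rightarrow> nat"
    where f: "\<forall>x \<in> X. \<forall>y \<in> X. meet x y \<longrightarrow> f x = f y" "card (f ` X) = n"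
    using assms(1) unfolding splits_def by blast
  have fin: "finite X" using assms(2) finite_V finite_subset by blast
  then obtain c where c: "c \<notin> f ` X"
    using ex_new_if_finite[of "f ` X"] by auto
  have apart: "\<not> meet x z" "\<not> meet z x" if "x \<in> X" "z \<in> Z" for x z
    using assms(4)[OF that(1)] assms(5)[OF that(2)] unfolding meet_def by auto
  have disj: "x \<notin> Z" if "x \<in> X" for x
    using assms(2) assms(4)[OF that] assms(5)[of x] l_le_r[of x] that by fastforce
  define g where "g = (\<lambda>x. if x \<in> Z then c else f x)"
  have "g x = g y" if "x \<in> X \<union> Z" "y \<in> X \<union> Z" "meet x y" for x y
    using that f(1) apart disj unfolding g_def by auto
  moreover have "g ` (X \<union> Z) = insert c (f ` X)"
    using disj assms(3) unfolding g_def by (auto simp: image_iff)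
  then have "card (g ` (X \<union> Z)) = Suc n"
    using c f(2) fin by simp
  ultimately show ?thesis unfolding splits_def by blast
qed

text \<open>
  In the next two definitions \<open>D\<close> is the set of eliminated intervals. A vertex of \<open>D\<close> with right
  endpoint beyond \<open>\<theta>\<close> was eliminated early; \<open>T\<close> contains all of these, so that \<open>T\<close> together with
  the running intervals separates everything in \<open>D\<close> from what starts after \<open>\<theta>\<close>. In \<open>history\<close>, \<open>Z\<close>
  is a set of intervals still to be eliminated, which count as part of the left side. In
  \<open>last_step\<close>, \<open>\<theta>\<close> is the right endpoint of the interval eliminated last: an interval of \<open>R\<close> ending
  before all running ones was passed over in that step, hence starts after \<open>\<theta>\<close>.
\<close>

definition history :: "'a set \<Rightarrow> 'a set \<Rightarrow> bool" where
  "history D W \<longleftrightarrow>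
     (\<forall>Z \<theta>. Z \<noteq> {} \<longrightarrow> Z \<subseteq> W \<longrightarrow> (\<forall>z \<in> Z. r z \<le> \<theta>) \<longrightarrow>
        (\<exists>T \<subseteq> D. (\<forall>x \<in> D. \<theta> < r x \<longrightarrow> x \<in> T) \<and> splits (D \<union> Z - T) (Suc (card T))))"

definition last_step :: "'a set \<Rightarrow> 'a set \<Rightarrow> 'a set \<Rightarrow> bool" where
  "last_step D F R \<longleftrightarrow>
     (\<forall>m. (\<forall>f \<in> F. m \<le> r f) \<longrightarrow> (\<exists>z \<in> R. r z < m) \<longrightarrow>
        (\<exists>\<theta>. \<exists>T \<subseteq> D. (\<forall>x \<in> D - T. r x \<le> \<theta>) \<and> splits (D - T) (Suc (card T)) \<and>
           (\<forall>z \<in> R. r z < m \<longrightarrow> \<theta> < l z)))"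

lemma historyE:
  assumes "history D W" "Z \<noteq> {}" "Z \<subseteq> W" "\<And>z. z \<in> Z \<Longrightarrow> r z \<le> \<theta>"
  obtains T where "T \<subseteq> D" "\<And>x. \<lbrakk>x \<in> D; \<theta> < r x\<rbrakk> \<Longrightarrow> x \<in> T" "splits (D \<union> Z - T) (Suc (card T))"
  using assms unfolding history_def by meson

lemma last_stepE:
  assumes "last_step D F R" "\<And>f. f \<in> F \<Longrightarrow> m \<le> r f" "z \<in> R" "r z < m"
  obtains \<theta> T where "T \<subseteq> D" "\<And>x. \<lbrakk>x \<in> D; x \<notin> T\<rbrakk> \<Longrightarrow> r x \<le> \<theta>" "splits (D - T) (Suc (card T))"
    "\<And>z. \<lbrakk>z \<in> R; r z < m\<rbrakk> \<Longrightarrow> \<theta> < l z"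
  using assms unfolding last_step_def by (metis DiffI)

text \<open>If \<open>v\<close> ends by \<open>\<theta>\<close>, it joins \<open>Z\<close> and the
  old history applies. Otherwise \<open>Z\<close> consists of intervals of \<open>R\<close> that end
  before \<open>v\<close>; by \<open>last_step\<close> they lie beyond an earlier cut and form a new
  class, paid for by putting \<open>v\<close> into the separator.\<close>

lemma history_step:
  assumes hist: "history D (F \<union> R)" and last: "last_step D F R"
    and V: "D \<union> F \<union> R \<subseteq> V" and vF: "v \<in> F" and disj: "D \<inter> (F \<union> R) = {}"
    and v_min: "\<And>f. f \<in> F \<Longrightarrow> r v \<le> r f"
  shows "history (insert v D) (F \<union> R - {v})"
  unfolding history_def
proof (intro allI impI)
  have vD: "v \<notin> D" using vF disj by blast
  fix Z \<theta>
  assume Z: "Z \<noteq> {}" "Z \<subseteq> F \<union> R - {v}" "\<forall>z \<in> Z. r z \<le> \<theta>"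
  show "\<exists>T \<subseteq> insert v D. (\<forall>x \<in> insert v D. \<theta> < r x \<longrightarrow> x \<in> T) \<and>
          splits (insert v D \<union> Z - T) (Suc (card T))"
  proof (cases "r v \<le> \<theta>")
    case True
    have "insert v Z \<subseteq> F \<union> R" using Z(2) vF by blast
    then obtain T where T: "T \<subseteq> D" "\<And>x. \<lbrakk>x \<in> D; \<theta> < r x\<rbrakk> \<Longrightarrow> x \<in> T"
        "splits (D \<union> insert v Z - T) (Suc (card T))"
      using historyE[OF hist, of "insert v Z" \<theta>] Z(3) True by blast
    moreover have "D \<union> insert v Z - T = insert v D \<union> Z - T" by blast
    ultimately show ?thesis using True by (intro exI[of _ T]) auto
  next
    case False
    have ZR: "Z \<subseteq> R" using Z False v_min by fastforce
    obtain z where z: "z \<in> Z" using Z(1) by blast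
    have "z \<in> R" "r z < r v" using z ZR Z(3) False by force+
    then obtain \<theta>' T where T: "T \<subseteq> D" "\<And>x. \<lbrakk>x \<in> D; x \<notin> T\<rbrakk> \<Longrightarrow> r x \<le> \<theta>'"
        "splits (D - T) (Suc (card T))" "\<And>z. \<lbrakk>z \<in> R; r z < r v\<rbrakk> \<Longrightarrow> \<theta>' < l z"
      using last_stepE[OF last v_min] by metis
    have later: "\<theta>' < l z" if "z \<in> Z" for z
      using T(4) ZR Z(3) False that by force
    have "z \<in> V" using z ZR V by blast
    \<comment> \<open>Hence whatever in \<open>D\<close> ends after \<open>\<theta>\<close> ends
      after \<open>\<theta>'\<close> and lies in \<open>T\<close>.\<close>
    then have "\<theta>' < \<theta>" using later[OF z] Z(3) z l_le_r by fastforce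
    have "splits (D - T \<union> Z) (Suc (Suc (card T)))"
      using T(2,3) V Z(1) later by (intro splits_append[where \<theta> = \<theta>']) auto
    moreover have "Z \<inter> insert v T = {}" using Z(2) T(1) disj by blast
    then have "insert v D \<union> Z - insert v T = D - T \<union> Z" using vD by blast
    moreover have "finite T" using T(1) V finite_V by (meson finite_subset le_sup_iff)
    then have "card (insert v T) = Suc (card T)" using vD T(1) by (metis card_insert_disjoint subsetD)
    moreover have "x \<in> insert v T" if "x \<in> insert v D" "\<theta> < r x" for x
      using T(2)[of x] \<open>\<theta>' < \<theta>\<close> that by force
    moreover have "insert v T \<subseteq> insert v D" using T(1) by blast
    ultimately show ?thesis by metis
  qed
qed

text \<open>The assumptions after \<open>tough\<close> are the sweep invariant: \<open>D\<close> is
  eliminated, \<open>F\<close> runs, \<open>R\<close> waits. The condition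
  \<open>l f \<le> r z\<close> ensures that a newcomer starting no later than the first right
  endpoint in \<open>F\<close> meets all of \<open>F\<close>.\<close>

lemma greedy:
  assumes tough: "\<And>S n. \<lbrakk>S \<subseteq> V; splits (V - S) n; 2 \<le> n\<rbrakk> \<Longrightarrow> n < card S"
    and "D \<union> F \<union> R = V" "D \<inter> F = {}" "D \<inter> R = {}" "F \<inter> R = {}" "card F = 3"
    and "\<And>x y. \<lbrakk>x \<in> F; y \<in> F\<rbrakk> \<Longrightarrow> meet x y"
    and "\<And>f z. \<lbrakk>f \<in> F; z \<in> R\<rbrakk> \<Longrightarrow> l f \<le> r z"
    and "history D (F \<union> R)" "last_step D F R"
  shows "ham_through meet (F \<union> R) F"
  using assms(2-)
proof (induction "card R" arbitrary: D F R rule: less_induct)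
  case less
  note V = less.prems(1) and disj = less.prems(2-4) and F3 = less.prems(5)
    and clique = less.prems(6) and started = less.prems(7)
    and hist = less.prems(8) and last = less.prems(9)
  have finF: "finite F" using F3 by (metis card.infinite zero_neq_numeral)
  have finR: "finite R" using V finite_V by auto
  show ?case
  proof (cases "R = {}")
    case True
    then show ?thesis using ham_through_triangle[OF F3] clique by simp
  next
    case False
    obtain v where v: "v \<in> F" "\<And>f. f \<in> F \<Longrightarrow> r v \<le> r f"
      using finF F3 arg_min_if_finite[of F r] by (metis card.empty not_less zero_neq_numeral)
    have "card (F - {v}) = 2" using F3 v(1) by simp
    then obtain p q where pq: "F - {v} = {p, q}" "p \<noteq> q" by (meson card_2_iff)
    have F: "F = {v, p, q}" using pq(1) v(1) by blast
    have vD: "v \<notin> D" using disj v(1) by blast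
    obtain T where T: "T \<subseteq> D" "\<And>x. \<lbrakk>x \<in> D; r v < r x\<rbrakk> \<Longrightarrow> x \<in> T"
        "splits (D \<union> {v} - T) (Suc (card T))"
      using historyE[OF hist, of "{v}" "r v"] v(1) by auto
    have early: "r x \<le> r v" if "x \<in> D \<union> {v} - T" for x
      using T(2) that by force
    define A where "A = {z \<in> R. l z \<le> r v}"
    \<comment> \<open>If the sweep were stuck, deleting \<open>T\<close>, \<open>p\<close> and
      \<open>q\<close> would leave \<open>card T + 2\<close> classes, against the strict bound in
      \<open>tough\<close>.\<close>
    have "A \<noteq> {}"
    proof
      assume "A = {}"
      then have "splits (D \<union> {v} - T \<union> R) (Suc (Suc (card T)))"
        using T(3) early False V v(1) unfolding A_def
        by (intro splits_append[where \<theta> = "r v"]) auto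
      moreover have "D \<union> {v} - T \<union> R = V - (T \<union> {p, q})"
        using V disj T(1) F pq by auto
      moreover have "T \<union> {p, q} \<subseteq> V" using T(1) V F by auto
      ultimately have "Suc (Suc (card T)) < card (T \<union> {p, q})"
        using tough by fastforce
      moreover have "card (T \<union> {p, q}) \<le> card T + card {p, q}" by (rule card_Un_le)
      ultimately show False using pq(2) by simp
    qed
    \<comment> \<open>The smallest right endpoint preserves the invariant: the rest of
      \<open>A\<close> ends no earlier than \<open>w\<close>, and the intervals outside
      \<open>A\<close> start after \<open>r v\<close>, hence after \<open>l w\<close>.\<close>
    then obtain w where w: "w \<in> A" "\<And>z. z \<in> A \<Longrightarrow> r w \<le> r z"
      using finR arg_min_if_finite[of A r] unfolding A_def
      by (metis (no_types, lifting) finite_subset mem_Collect_eq not_less subsetI)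
    have wR: "w \<in> R" "l w \<le> r v" using w(1) unfolding A_def by auto
    define F' R' where "F' = {p, q, w}" and "R' = R - {w}"
    have wF: "w \<notin> F" "w \<notin> D" using disj wR by auto
    have meet_w: "meet x w" "meet w x" if "x \<in> F" for x
      using that v(2) wR started unfolding meet_def by (meson order_trans)+
    have W: "F \<union> R - {v} = F' \<union> R'"
      using F pq wR disj unfolding F'_def R'_def by auto
    have "ham_through meet (F' \<union> R') F'"
    proof (rule less.hyps)
      show "card R' < card R" using wR finR unfolding R'_def by (intro card_Diff1_less)
      show "insert v D \<union> F' \<union> R' = V" using V F wR unfolding F'_def R'_def by auto
      show "insert v D \<inter> F' = {}" using vD wF pq disj F unfolding F'_def by auto
      show "insert v D \<inter> R' = {}" using v disj unfolding R'_def by auto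
      show "F' \<inter> R' = {}" using F disj unfolding F'_def R'_def by auto
      have "w \<noteq> p" "w \<noteq> q" using wF(1) F by blast+
      then show "card F' = 3" using pq(2) unfolding F'_def by simp
      show "meet x y" if "x \<in> F'" "y \<in> F'" for x y
      proof -
        have "meet w w" using l_le_r[of w] wR(1) V unfolding meet_def by blast
        moreover have "x \<in> F \<or> x = w" "y \<in> F \<or> y = w" using that F unfolding F'_def by auto
        ultimately show ?thesis using clique meet_w by metis
      qed
      show "l f \<le> r z" if "f \<in> F'" "z \<in> R'" for f z
      proof (cases "f = w")
        case True
        have "z \<in> R" "z \<in> V" "w \<in> V" using that V wR unfolding R'_def by auto
        show ?thesis
        proof (cases "z \<in> A")
          case True
          then show ?thesis using w(2)[of z] l_le_r[OF \<open>w \<in> V\<close>] \<open>f = w\<close> by simp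
        next
          case False
          then show ?thesis using \<open>z \<in> R\<close> wR l_le_r[OF \<open>z \<in> V\<close>] \<open>f = w\<close> unfolding A_def by simp
        qed
      next
        case False
        then show ?thesis using that started F unfolding F'_def R'_def by auto
      qed
      show "history (insert v D) (F' \<union> R')"
        using history_step[OF hist last _ v(1) _ v(2)] V W disj by (simp add: Int_Un_distrib)
      show "last_step (insert v D) F' R'"
        unfolding last_step_def
      proof (intro allI impI)
        fix m assume m: "\<forall>f \<in> F'. m \<le> r f"
        \<comment> \<open>Ending before \<open>w\<close>, such a \<open>z\<close> cannot have been a
          candidate in \<open>A\<close>; so the cut at \<open>r v\<close> with the same
          \<open>T\<close> works.\<close>
        have "r v < l z" if "z \<in> R'" "r z < m" for z
        proof -
          have "r z < r w" using m that unfolding F'_def by force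
          then have "z \<notin> A" using w(2) by force
          then show ?thesis using that unfolding A_def R'_def by auto
        qed
        moreover have "D \<union> {v} - T = insert v D - T" by blast
        ultimately show "\<exists>\<theta>. \<exists>T \<subseteq> insert v D. (\<forall>x \<in> insert v D - T. r x \<le> \<theta>) \<and>
            splits (insert v D - T) (Suc (card T)) \<and> (\<forall>z \<in> R'. r z < m \<longrightarrow> \<theta> < l z)"
          using T(1,3) early by (intro exI[of _ "r v"] exI[of _ T]) auto
      qed
    qed
    then have "ham_through meet (insert v (F' \<union> R')) {v, p, q}"
      unfolding F'_def
    proof (rule ham_through_insert)
      show "v \<notin> {p, q, w} \<union> R'" using W unfolding F'_def by blast
      show "meet v x \<and> meet x v" if "x \<in> {p, q, w}" for x
        using that meet_w clique F by auto
    qed (use pq in auto)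
    moreover have "insert v (F' \<union> R') = F \<union> R" using W v(1) by blast
    ultimately show ?thesis using F by simp
  qed
qed

text \<open>The sweep starts with the interval \<open>u\<close> that ends first and two intervals
  meeting it; all three contain the point \<open>r u\<close>.\<close>

lemma hamilton_connected_if_tough:
  assumes tough: "\<And>S n. \<lbrakk>S \<subseteq> V; splits (V - S) n; 2 \<le> n\<rbrakk> \<Longrightarrow> n < card S"
    and st: "s \<in> V" "t \<in> V" "s \<noteq> t"
  obtains p where "distinct p" "set p = V" "hd p = s" "last p = t" "successively meet p"
proof -
  obtain u where u: "u \<in> V" "\<And>x. x \<in> V \<Longrightarrow> r u \<le> r x"
    using finite_V st(1) arg_min_if_finite[of V r] by (metis empty_iff not_less)
  define A where "A = {z \<in> V - {u}. l z \<le> r u}"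
  have A: "A \<subseteq> V" "u \<notin> A" "finite A" using finite_V unfolding A_def by auto
  have meet_u: "meet u x" "meet x u" if "x \<in> A" for x
    using that u l_le_r[of u] unfolding A_def meet_def by (auto intro: order_trans)
  show ?thesis
  proof (cases "2 \<le> card A")
    case True
    then obtain B where "B \<subseteq> A" "card B = 2" by (meson obtain_subset_with_card_n)
    then obtain f g where fg: "f \<in> A" "g \<in> A" "f \<noteq> g" by (metis card_2_iff insert_subset)
    define F where "F = {u, f, g}"
    have F: "F \<subseteq> V" "card F = 3" using fg u A(1,2) unfolding F_def by (auto simp: card_insert_if)
    have low: "l x \<le> r u" if "x \<in> F" for x
      using that fg u l_le_r[of u] unfolding F_def A_def by auto
    have "ham_through meet (F \<union> (V - F)) F"
    proof (rule greedy[OF tough, where D = "{}"])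
      show "meet x y" if "x \<in> F" "y \<in> F" for x y
        using that F low u(2) unfolding meet_def by (meson order_trans subsetD)
      show "l x \<le> r z" if "x \<in> F" "z \<in> V - F" for x z
        using that low[of x] u(2)[of z] by auto
      show "history {} (F \<union> (V - F))"
        unfolding history_def by (auto intro: splits_one[simplified])
      \<comment> \<open>Vacuous: nothing ends before \<open>u\<close>, which is in
        \<open>F\<close>.\<close>
      show "last_step {} F (V - F)"
        unfolding last_step_def F_def using u(2) by fastforce
    qed (use F in auto)
    moreover have "F \<union> (V - F) = V" using F by blast
    ultimately show ?thesis using st that ham_through_path by metis
  next
    case False
    \<comment> \<open>Otherwise deleting \<open>A\<close>, at most one vertex, would cut
      \<open>u\<close> off from the rest.\<close>
    have "V = insert u A"
    proof (rule ccontr)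
      assume neq: "V \<noteq> insert u A"
      have "splits ({u} \<union> (V - insert u A)) (Suc 1)"
      proof (rule splits_append[where \<theta> = "r u"])
        show "splits {u} 1" by (rule splits_one) simp
      qed (use neq u A in \<open>auto simp: A_def\<close>)
      moreover have "{u} \<union> (V - insert u A) = V - A" using u A by blast
      ultimately show False using tough[of A 2] A False by (simp add: numeral_2_eq_2)
    qed
    then have "\<exists>x. A = {x}"
      using False st A card_1_singleton_iff[of A] by (cases "card A") auto
    then obtain x where x: "A = {x}" by blast
    have "x \<noteq> u" using A x by auto
    show ?thesis
      using st \<open>V = insert u A\<close> x meet_u by (intro that[of "[s, t]"]) auto
  qed
qed

end

section \<open>Segments of a path\<close>

text \<open>Deleting \<open>S\<close> cuts the path into at most one segment more than it has
  vertices in \<open>S\<close>, one fewer for each end in \<open>S\<close>, and \<open>f\<close> is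
  constant on segments. A one-vertex path in \<open>S\<close> counts as both ends.\<close>

lemma segments_bound:
  assumes "successively E p" "p \<noteq> []"
    and "\<And>x y. \<lbrakk>E x y; x \<notin> S; y \<notin> S\<rbrakk> \<Longrightarrow> f x = f y"
  shows "card (f ` (set p - S)) + of_bool (hd p \<in> S) + of_bool (last p \<in> S)
    \<le> Suc (length (filter (\<lambda>x. x \<in> S) p))"
  using assms(1,2)
proof (induction p rule: induct_list012)
  case (2 x)
  then show ?case by (cases "x \<in> S") (auto simp: insert_Diff_if)
next
  case (3 x y zs)
  let ?q = "y # zs"
  have IH: "card (f ` (set ?q - S)) + of_bool (y \<in> S) + of_bool (last ?q \<in> S)
      \<le> Suc (length (filter (\<lambda>x. x \<in> S) ?q))"
    using 3 by simp
  show ?case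
  proof (cases "x \<in> S")
    case True
    then have "set (x # ?q) - S = set ?q - S" by auto
    then have "card (f ` (set (x # ?q) - S)) = card (f ` (set ?q - S))" by (rule arg_cong)
    then show ?thesis using True IH by simp
  next
    case False
    then have img: "f ` (set (x # ?q) - S) = insert (f x) (f ` (set ?q - S))" by auto
    show ?thesis
    proof (cases "y \<in> S")
      case True
      \<comment> \<open>The possible new value is offset by \<open>y\<close>, which is no longer the
        head.\<close>
      have "card (f ` (set (x # ?q) - S)) \<le> Suc (card (f ` (set ?q - S)))"
        unfolding img by (simp add: card_insert_if)
      then show ?thesis using True False IH by simp
    next
      case y: False
      then have "f x = f y" using False assms(3) 3 by simp
      then have "f ` (set (x # ?q) - S) = f ` (set ?q - S)"
        unfolding img using y by (simp add: insert_absorb)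
      then show ?thesis using y False IH by simp
    qed
  qed
qed simp

text \<open>An interval meets itself, but adjacency is irreflexive; distinctness bridges the
  difference.\<close>

lemma distinct_successively_mono:
  assumes "distinct p" "successively E p"
    and "\<And>x y. \<lbrakk>x \<in> set p; y \<in> set p; x \<noteq> y; E x y\<rbrakk> \<Longrightarrow> E' x y"
  shows "successively E' p"
  using assms by (induction p rule: induct_list012) auto

section \<open>Vertex deletion, components and the scattering number\<close>

lemma successively_iff_vwalk_arcs:
  "successively (\<lambda>x y. (x, y) \<in> A) p \<longleftrightarrow> set (vwalk_arcs p) \<subseteq> A"
  by (induction p rule: vwalk_arcs.induct) auto

lemma arcs_ends_induce:
  "(u, v) \<in> arcs_ends (G \<restriction> X) \<longleftrightarrow> (u, v) \<in> arcs_ends G \<and> u \<in> X \<and> v \<in> X"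
  by (auto simp: arcs_ends_conv)

lemma verts_del_verts [simp]: "verts (del_verts G S) = verts G - S"
  by (simp add: del_verts_def)

lemma arcs_ends_del_verts:
  assumes "wf_digraph G"
  shows "(u, v) \<in> arcs_ends (del_verts G S) \<longleftrightarrow> (u, v) \<in> arcs_ends G \<and> u \<notin> S \<and> v \<notin> S"
  unfolding del_verts_def arcs_ends_induce
  using wf_digraph.adj_in_verts[OF assms, of u v] by auto

lemma wf_del_verts: "wf_digraph G \<Longrightarrow> wf_digraph (del_verts G S)"
  unfolding del_verts_def by (rule wf_digraph.wellformed_induce_subgraph)

lemma num_components_conv:
  assumes "wf_digraph H"
  shows "num_components H = card (pre_digraph.scc_of H ` verts H)"
  unfolding num_components_def
  using wf_digraph.card_sccs_verts[OF assms] wf_digraph.sccs_verts_conv_scc_of[OF assms] by metis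

text \<open>Being constant along arcs, \<open>f\<close> is constant on each component and so factors
  through the set of components.\<close>

lemma card_image_le_num_components:
  assumes "wf_digraph H" "finite (verts H)"
    and "\<And>u v. u \<rightarrow>\<^bsub>H\<^esub> v \<Longrightarrow> f u = f v"
  shows "card (f ` verts H) \<le> num_components H"
proof -
  interpret wf_digraph H by fact
  have reach: "f u = f v" if "u \<rightarrow>\<^sup>*\<^bsub>H\<^esub> v" for u v
    using that by (induction rule: converse_reachable_induct) (auto dest: assms(3))
  have "f ` scc_of u = {f u}" if "u \<in> verts H" for u
  proof -
    have "f v = f u" if "v \<in> scc_of u" for v
      using reach[of v u] that unfolding scc_of_def by blast
    then show ?thesis using in_scc_of_self[OF that] by blast
  qed
  then have "f u = the_elem (f ` scc_of u)" if "u \<in> verts H" for u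
    using that by simp
  then have "f ` verts H \<subseteq> (\<lambda>C. the_elem (f ` C)) ` scc_of ` verts H" by blast
  then show ?thesis
    unfolding num_components_conv[OF assms(1)] using assms(2) by (intro surj_card_le) auto
qed

lemma scc_of_eq_if_arc:
  assumes "sym_digraph H" "u \<rightarrow>\<^bsub>H\<^esub> v"
  shows "pre_digraph.scc_of H u = pre_digraph.scc_of H v"
proof -
  interpret sym_digraph H by fact
  have "u \<rightarrow>\<^sup>*\<^bsub>H\<^esub> v" using assms(2) by (rule reachable_adjI)
  moreover from this have "v \<rightarrow>\<^sup>*\<^bsub>H\<^esub> u" by (rule symmetric_reachable')
  ultimately show ?thesis unfolding scc_of_def by (auto intro: reachable_trans)
qed

lemma sym_del_verts:
  assumes "graph G"
  shows "sym_digraph (del_verts G S)"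
proof -
  interpret graph G by fact
  have "symmetric (del_verts G S)"
    using arcs_ends_symmetric[OF sym_arcs] arcs_ends_del_verts[OF wf_digraph]
    unfolding symmetric_def by (auto intro!: symI)
  then show ?thesis using wf_del_verts[OF wf_digraph] by (rule wf_digraph.sym_digraphI[rotated])
qed

lemma num_components_le_one:
  assumes "graph G" "complete_graph G"
  shows "num_components (del_verts G S) \<le> 1"
proof -
  interpret graph G by fact
  let ?f = "pre_digraph.scc_of (del_verts G S)"
  have "?f u = ?f v"
    if "u \<in> verts G - S" "v \<in> verts G - S" for u v
  proof (cases "u = v")
    case False
    then have "u \<rightarrow>\<^bsub>del_verts G S\<^esub> v"
      using that assms(2) unfolding arcs_ends_del_verts[OF wf_digraph] complete_graph_def
        complete_digraph_def by auto
    then show ?thesis by (rule scc_of_eq_if_arc[OF sym_del_verts[OF assms(1)]])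
  qed simp
  then have "\<forall>x \<in> ?f ` (verts G - S). \<forall>y \<in> ?f ` (verts G - S). x = y" by blast
  moreover have "finite (?f ` (verts G - S))" by simp
  ultimately show ?thesis
    unfolding num_components_conv[OF wf_del_verts[OF wf_digraph]] verts_del_verts One_nat_def
    by (simp only: card_le_Suc0_iff_eq)
qed

lemma scattering_number_le_iff:
  assumes "graph G"
  shows "scattering_number G \<le> ereal (- (real k + 1)) \<longleftrightarrow>
    (\<forall>S \<subseteq> verts G. 2 \<le> num_components (del_verts G S) \<longrightarrow>
       num_components (del_verts G S) + k < card S)"
proof (cases "complete_graph G")
  case True
  have "\<not> 2 \<le> num_components (del_verts G S)" for S
    using num_components_le_one[OF assms True, of S] by simp
  then show ?thesis using True unfolding scattering_number_def by simp
next
  case False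
  interpret graph G by fact
  let ?c = "\<lambda>S. num_components (del_verts G S)"
  let ?A = "{real (?c S) - real (card S) | S. S \<subseteq> verts G \<and> ?c S \<ge> 2}"
  have "finite ?A"
    using finite_subset[of ?A "(\<lambda>S. real (?c S) - real (card S)) ` Pow (verts G)"] by auto
  moreover have "?A \<noteq> {}"
  proof -
    have "arcs_ends G \<noteq> {(u, v). (u, v) \<in> verts G \<times> verts G \<and> u \<noteq> v}"
      using False assms unfolding complete_graph_def complete_digraph_def by simp
    moreover have "arcs_ends G \<subseteq> {(u, v). (u, v) \<in> verts G \<times> verts G \<and> u \<noteq> v}"
      using adj_in_verts adj_not_same by auto
    ultimately obtain u v where uv: "u \<in> verts G" "v \<in> verts G" "u \<noteq> v" "\<not> u \<rightarrow>\<^bsub>G\<^esub> v"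
      by auto
    then have "\<not> v \<rightarrow>\<^bsub>G\<^esub> u" using arcs_ends_symmetric[OF sym_arcs] by blast
    moreover have V: "verts G - (verts G - {u, v}) = {u, v}" using uv by blast
    \<comment> \<open>Only \<open>u\<close> and \<open>v\<close> are kept and no arc remains, so
      \<open>id\<close> is admissible and yields two components.\<close>
    ultimately have "card (id ` verts (del_verts G (verts G - {u, v}))) \<le> ?c (verts G - {u, v})"
      using uv adj_not_same adj_in_verts
      by (intro card_image_le_num_components wf_del_verts wf_digraph)
        (auto simp: arcs_ends_del_verts[OF wf_digraph])
    then have "2 \<le> ?c (verts G - {u, v})" using uv(3) V by simp
    then show ?thesis by blast
  qed
  ultimately have "Max ?A \<le> - (real k + 1) \<longleftrightarrow> (\<forall>a \<in> ?A. a \<le> - (real k + 1))"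
    by (rule Max_le_iff)
  also have "\<dots> \<longleftrightarrow> (\<forall>S \<subseteq> verts G. 2 \<le> ?c S \<longrightarrow> real (?c S) - real (card S) \<le> - (real k + 1))"
    by blast
  also have "\<dots> \<longleftrightarrow> (\<forall>S \<subseteq> verts G. 2 \<le> ?c S \<longrightarrow> ?c S + k < card S)"
    by (intro all_cong imp_cong refl) linarith
  finally show ?thesis using False unfolding scattering_number_def by simp
qed

section \<open>The two directions for graphs\<close>

lemma hamilton_path_components:
  assumes "graph G" "hamilton_path (del_verts G S') s p t" "S' \<subseteq> S" "S \<subseteq> verts G"
  shows "num_components (del_verts G S) + of_bool (s \<in> S) + of_bool (t \<in> S)
    \<le> Suc (card S - card S')"
proof -
  interpret graph G by fact
  let ?f = "pre_digraph.scc_of (del_verts G S)"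
  have p: "distinct p" "set p = verts G - S'" "hd p = s" "last p = t" "p \<noteq> []"
    "set (vwalk_arcs p) \<subseteq> arcs_ends (del_verts G S')"
    using assms(2) unfolding hamilton_path_def vpath_def vwalk_def by auto
  have "card (?f ` (set p - S)) + of_bool (hd p \<in> S) + of_bool (last p \<in> S)
      \<le> Suc (length (filter (\<lambda>x. x \<in> S) p))"
  proof (rule segments_bound)
    show "successively (\<lambda>x y. x \<rightarrow>\<^bsub>del_verts G S'\<^esub> y) p"
      using p(6) by (simp add: successively_iff_vwalk_arcs)
    show "?f x = ?f y" if "x \<rightarrow>\<^bsub>del_verts G S'\<^esub> y" "x \<notin> S" "y \<notin> S" for x y
      using that by (intro scc_of_eq_if_arc sym_del_verts assms(1))
        (simp add: arcs_ends_del_verts[OF wf_digraph])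
  qed (rule p)
  moreover have "set p - S = verts (del_verts G S)" using p(2) assms(3) by auto
  moreover have "length (filter (\<lambda>x. x \<in> S) p) = card (S - S')"
  proof -
    have "set (filter (\<lambda>x. x \<in> S) p) = S - S'" using p(2) assms(4) by auto
    then show ?thesis using distinct_card[of "filter (\<lambda>x. x \<in> S) p"] p(1) by simp
  qed
  moreover have "card (S - S') = card S - card S'"
    using assms(3,4) by (meson card_Diff_subset finite_subset finite_verts)
  ultimately show ?thesis
    using p(3,4) num_components_conv[OF wf_del_verts[OF wf_digraph]] by simp
qed

lemma k_hamilton_connected_imp_tough:
  assumes "graph G" "k_hamilton_connected k G" "S \<subseteq> verts G"
    and "2 \<le> num_components (del_verts G S)"
  shows "num_components (del_verts G S) + k < card S"
proof -
  interpret graph G by fact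
  have finS: "finite S" using assms(3) finite_verts by (rule finite_subset)
  have "2 \<le> card (verts G - S)"
    using assms(4) card_image_le[of "verts G - S"]
    unfolding num_components_conv[OF wf_del_verts[OF wf_digraph]] by (force intro: order_trans)
  then obtain a b where ab: "a \<in> verts G - S" "b \<in> verts G - S" "a \<noteq> b"
    by (meson card_2_iff' obtain_subset_with_card_n subsetD)
  have bound: "num_components (del_verts G S) + of_bool (s \<in> S) + of_bool (t \<in> S)
      \<le> Suc (card S - card S')"
    if h: "S' \<subseteq> S" "card S' \<le> k" "s \<in> verts G - S'" "t \<in> verts G - S'" "s \<noteq> t" for S' s t
  proof -
    have "hamilton_connected (del_verts G S')"
      using assms(2,3) h(1,2) unfolding k_hamilton_connected_def by blast
    then obtain p where "hamilton_path (del_verts G S') s p t"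
      using h(3-5) unfolding hamilton_connected_def verts_del_verts by blast
    then show ?thesis by (rule hamilton_path_components[OF assms(1) _ h(1) assms(3)])
  qed
  show ?thesis
  proof (cases "k < card S")
    case False
    \<comment> \<open>All of \<open>S\<close> may be deleted here; a Hamilton path of the rest
      leaves at most one component, a contradiction.\<close>
    then show ?thesis using bound[of S a b] ab assms(4) by simp
  next
    case True
    then obtain S' where S': "S' \<subseteq> S" "card S' = k"
      by (meson less_imp_le obtain_subset_with_card_n)
    have card_diff: "card (S - S') = card S - k"
      using S' finS by (simp add: card_Diff_subset finite_subset)
    then obtain s where s: "s \<in> S - S'"
      using True by (metis card.empty equals0I zero_less_diff less_irrefl)
    \<comment> \<open>One end in \<open>S\<close> already gives \<open>card S - k \<ge> 2\<close>,
      which supplies the second end \<open>t\<close> in \<open>S - S'\<close>.\<close>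
    have "num_components (del_verts G S) + 1 \<le> Suc (card S - k)"
      using bound[of S' s a] S' s ab assms(3) by fastforce
    then have "card (S - S' - {s}) \<noteq> 0" using assms(4) card_diff s finS by simp
    then obtain t where t: "t \<in> S - S'" "t \<noteq> s" by (metis DiffE card.empty equals0I insertI1)
    have "num_components (del_verts G S) + 2 \<le> Suc (card S - k)"
      using bound[of S' s t] S' s t assms(3) by fastforce
    then show ?thesis by linarith
  qed
qed

text \<open>A separator \<open>T\<close> of \<open>G - S\<close> gives the separator
  \<open>S \<union> T\<close> of \<open>G\<close>; the surplus \<open>k\<close> absorbs the at most
  \<open>k\<close> vertices of \<open>S\<close>, leaving the bound for \<open>k = 0\<close>.\<close>

lemma tough_imp_k_hamilton_connected:
  assumes "interval_graph G"
    and tough: "\<And>S. \<lbrakk>S \<subseteq> verts G; 2 \<le> num_components (del_verts G S)\<rbrakk> \<Longrightarrow>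
      num_components (del_verts G S) + k < card S"
  shows "k_hamilton_connected k G"
  unfolding k_hamilton_connected_def hamilton_connected_def
proof (intro allI ballI impI, elim conjE)
  fix S s t
  assume S: "S \<subseteq> verts G" "card S \<le> k"
    and st: "s \<in> verts (del_verts G S)" "t \<in> verts (del_verts G S)" "s \<noteq> t"
  obtain l r :: "'a \<Rightarrow> real" where lr: "\<And>v. v \<in> verts G \<Longrightarrow> l v \<le> r v"
    "\<And>u v. \<lbrakk>u \<in> verts G; v \<in> verts G\<rbrakk> \<Longrightarrow>
       u \<rightarrow>\<^bsub>G\<^esub> v \<longleftrightarrow> u \<noteq> v \<and> {l u..r u} \<inter> {l v..r v} \<noteq> {}"
    using assms(1) unfolding interval_graph_def by metis
  interpret graph G using assms(1) unfolding interval_graph_def by blast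
  interpret interval_family "verts G - S" l r
    by unfold_locales (use lr in auto)
  have arc_iff: "u \<rightarrow>\<^bsub>G\<^esub> v \<longleftrightarrow> u \<noteq> v \<and> meet u v"
    if "u \<in> verts G" "v \<in> verts G" for u v
    using lr(1)[OF that(1)] lr(1)[OF that(2)] lr(2)[OF that] unfolding meet_def
    by (auto simp: Int_atLeastAtMost)
  have "n < card T" if T: "T \<subseteq> verts G - S" "splits (verts G - S - T) n" "2 \<le> n" for T n
  proof -
    have V: "verts G - (S \<union> T) = verts G - S - T" by blast
    obtain f :: "'a \<Rightarrow> nat"
      where f: "\<And>x y. \<lbrakk>x \<in> verts G - S - T; y \<in> verts G - S - T; meet x y\<rbrakk> \<Longrightarrow> f x = f y"
        "card (f ` (verts G - S - T)) = n"
      using T(2) unfolding splits_def by metis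
    have "card (f ` verts (del_verts G (S \<union> T))) \<le> num_components (del_verts G (S \<union> T))"
    proof (rule card_image_le_num_components)
      show "f u = f v" if "u \<rightarrow>\<^bsub>del_verts G (S \<union> T)\<^esub> v" for u v
      proof -
        have "u \<rightarrow>\<^bsub>G\<^esub> v" "u \<notin> S \<union> T" "v \<notin> S \<union> T"
          using that by (auto simp: arcs_ends_del_verts[OF wf_digraph])
        then show ?thesis using adj_in_verts[of u v] arc_iff[of u v] f(1)[of u v] by simp
      qed
    qed (auto intro: wf_del_verts wf_digraph)
    then have "n \<le> num_components (del_verts G (S \<union> T))" using f(2) V by simp
    moreover from this have "num_components (del_verts G (S \<union> T)) + k < card (S \<union> T)"
      using S T by (intro tough) auto
    moreover have "card (S \<union> T) \<le> card S + card T" by (rule card_Un_le)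
    ultimately show ?thesis using S(2) by linarith
  qed
  then obtain p where p: "distinct p" "set p = verts G - S" "hd p = s" "last p = t"
      "successively meet p"
    using hamilton_connected_if_tough[of s t] st by auto
  have "successively (\<lambda>x y. x \<rightarrow>\<^bsub>del_verts G S\<^esub> y) p"
    using distinct_successively_mono[OF p(1,5)] p(2) arc_iff
    by (simp add: arcs_ends_del_verts[OF wf_digraph])
  then have "hamilton_path (del_verts G S) s p t"
    using p st unfolding hamilton_path_def vpath_def vwalk_def successively_iff_vwalk_arcs
    by auto
  then show "\<exists>p. hamilton_path (del_verts G S) s p t" ..
qed

theorem theorem3:
  fixes G :: "('a, 'b) pre_digraph" and k :: nat
  assumes "interval_graph G"
  shows "k_hamilton_connected k G \<longleftrightarrow> scattering_number G \<le> ereal (- (real k + 1))"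
proof -
  have "graph G" using assms unfolding interval_graph_def by blast
  then show ?thesis
    using scattering_number_le_iff k_hamilton_connected_imp_tough
      tough_imp_k_hamilton_connected[OF assms] by metis
qed

end
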